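(* Let $h$ be a dimension function, let $N\in\mathbb{N}$, and let $\mathcal{F}$ be a family of continuous functions from $\mathbb{R}^N$ to $\mathbb{R}^N$. Suppose there exist a sequence $\Psi=(\psi_j)_j$ of closed and locally bilipschitz functions $\psi_j:\Omega_j\to\mathbb{R}^N$ defined on closed sets $\Omega_j\subseteq\mathbb{R}^N$, an integer $L\ge2$, and an assignment $f\mapsto r(f)$ of an index to each $f\in\mathcal{F}$, such that: (i) for each $f\in\mathcal{F}$, the composition $f\circ\psi_{r(f)}$ is well defined and bilipschitz with constants $(1,L)$ on $\Omega_{r(f)}$; (ii) for every countable collection $(f_i)_{i\in\Lambda}\subseteq\mathcal{F}$, $\Lambda\subseteq\mathbb{N}$, the set $$A_{\{f_i:\,i\in\Lambda\}}:=\bigcap_{i\in\Lambda}f_i\circ\psi_{r(f_i)}(\Omega_{r(f_i)})$$ contains arbitrarily large balls. Then there exists an $\mathcal{F}_\sigma$ set $E\subseteq\mathbb{R}^N$ without isolated points, with $\mathcal{H}^h(E)=0$, such that $\bigcap_{i\in\Lambda}f_i(E)\neq\emptyset$ for any countable family $\{f_i:i\in\Lambda\}\subseteq\mathcal{F}$.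
   Context: A dimension function is a function $h:\mathbb{R}_{\ge0}\to\mathbb{R}\cup\{+\infty\}$ that is non-decreasing and right continuous, with $h(0)=0$ and $h(t)>0$ for $t>0$. The associated (outer) Hausdorff measure is $\mathcal{H}^h(E)=\lim_{\delta\to0}\inf\{\sum_i h(|U_i|):\{U_i\}_i\text{ a (countable) }\delta\text{-covering of }E\}$, where $|U|$ is the diameter of $U$ and a $\delta$-covering is a covering by sets of diameter at most $\delta$. A map $g:X\to\mathbb{R}^N$, $X\subseteq\mathbb{R}^N$, is bilipschitz with constants $(c_1,c_2)$, $c_1,c_2>0$, if $c_1\|x-y\|\le\|g(x)-g(y)\|\le c_2\|x-y\|$ for all $x,y\in X$. A map $\psi:\Omega\to\mathbb{R}^N$, $\Omega\subseteq\mathbb{R}^N$, is locally bilipschitz if for every $x_0\in\Omega$ there are $\varepsilon>0$ and $c_1,c_2>0$ (depending on $x_0$) such that $c_1\|x-y\|\le\|\psi(x)-\psi(y)\|\le c_2\|x-y\|$ for all $x,y\in B(x_0,\varepsilon)\cap\Omega$. A map is closed if it sends closed subsets of its domain to closed subsets of its codomain. A set contains arbitrarily large balls if for every $\rho>0$ it contains a ball of $\mathbb{R}^N$ of radius $\rho$. An $\mathcal{F}_\sigma$ set is a countable union of closed sets. *)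

theory Defs
  imports "HOL-Analysis.Analysis"
begin

text \<open>
  A dimension function maps \<open>[0, \<infinity>)\<close> to \<open>\<real> \<union> {+\<infinity>}\<close>; as it is non-decreasing with \<open>h 0 = 0\<close>,
  its values lie in \<^typ>\<open>ennreal\<close>. The values at negative arguments are unconstrained and
  never used.
\<close>

definition dimension_function :: "(real \<Rightarrow> ennreal) \<Rightarrow> bool" where
  "dimension_function h \<longleftrightarrow>
     mono_on {0..} h \<and> (\<forall>t\<ge>0. continuous (at_right t) h) \<and> h 0 = 0 \<and> (\<forall>t>0. 0 < h t)"

text \<open>
  Finite coverings are included, since a sequence may be padded with empty sets. Boundedness
  has to be required separately, because \<^const>\<open>diameter\<close> is unspecified on unbounded sets.
\<close>

definition delta_covering :: "real \<Rightarrow> (nat \<Rightarrow> 'a::metric_space set) \<Rightarrow> 'a set \<Rightarrow> bool" where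
  "delta_covering \<delta> U E \<longleftrightarrow>
     E \<subseteq> (\<Union>i. U i) \<and> (\<forall>i. bounded (U i) \<and> diameter (U i) \<le> \<delta>)"

definition hausdorff_premeasure ::
  "(real \<Rightarrow> ennreal) \<Rightarrow> real \<Rightarrow> 'a::metric_space set \<Rightarrow> ennreal" where
  "hausdorff_premeasure h \<delta> E = (INF U\<in>{U. delta_covering \<delta> U E}. \<Sum>i. h (diameter (U i)))"

definition hausdorff_measure ::
  "(real \<Rightarrow> ennreal) \<Rightarrow> 'a::metric_space set \<Rightarrow> ennreal" where
  "hausdorff_measure h E = Lim (at_right 0) (\<lambda>\<delta>. hausdorff_premeasure h \<delta> E)"

lemma hausdorff_premeasure_antimono:
  assumes "\<delta> \<le> \<delta>'"
  shows "hausdorff_premeasure h \<delta>' E \<le> hausdorff_premeasure h \<delta> E"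
  unfolding hausdorff_premeasure_def
  by (rule INF_superset_mono) (use assms in \<open>auto simp: delta_covering_def intro: order_trans\<close>)

text \<open>The limit in the definition always exists.\<close>

lemma hausdorff_premeasure_tendsto_SUP:
  "((\<lambda>\<delta>. hausdorff_premeasure h \<delta> E) \<longlongrightarrow> (SUP \<delta>\<in>{0<..}. hausdorff_premeasure h \<delta> E)) (at_right 0)"
proof (rule order_tendstoI)
  fix a assume "a < (SUP \<delta>\<in>{0<..}. hausdorff_premeasure h \<delta> E)"
  then obtain d where d: "0 < d" "a < hausdorff_premeasure h d E"
    by (auto simp: less_SUP_iff)
  have "\<forall>\<^sub>F x in at_right 0. x < d"
    using d(1) by (rule order_tendstoD(2)[OF tendsto_ident_at])
  then show "\<forall>\<^sub>F x in at_right 0. a < hausdorff_premeasure h x E"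
    by eventually_elim (rule less_le_trans[OF d(2) hausdorff_premeasure_antimono[OF less_imp_le]])
next
  fix a assume a: "(SUP \<delta>\<in>{0<..}. hausdorff_premeasure h \<delta> E) < a"
  have "\<forall>\<^sub>F x in at_right (0::real). 0 < x"
    by (rule eventually_at_right_less)
  then show "\<forall>\<^sub>F x in at_right 0. hausdorff_premeasure h x E < a"
    by eventually_elim (rule le_less_trans[OF SUP_upper a], simp)
qed

lemma hausdorff_measure_tendsto:
  "((\<lambda>\<delta>. hausdorff_premeasure h \<delta> E) \<longlongrightarrow> hausdorff_measure h E) (at_right 0)"
  using hausdorff_premeasure_tendsto_SUP[of h E]
  by (simp add: hausdorff_measure_def tendsto_Lim)

definition bilipschitz_on ::
  "real \<Rightarrow> real \<Rightarrow> 'a::real_normed_vector set \<Rightarrow> ('a \<Rightarrow> 'b::real_normed_vector) \<Rightarrow> bool" where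
  "bilipschitz_on c1 c2 X g \<longleftrightarrow> 0 < c1 \<and> 0 < c2 \<and>
     (\<forall>x\<in>X. \<forall>y\<in>X. c1 * norm (x - y) \<le> norm (g x - g y) \<and>
                      norm (g x - g y) \<le> c2 * norm (x - y))"

definition locally_bilipschitz_on ::
  "'a::real_normed_vector set \<Rightarrow> ('a \<Rightarrow> 'b::real_normed_vector) \<Rightarrow> bool" where
  "locally_bilipschitz_on \<Omega> \<psi> \<longleftrightarrow>
     (\<forall>x0\<in>\<Omega>. \<exists>\<epsilon>>0. \<exists>c1 c2. bilipschitz_on c1 c2 (ball x0 \<epsilon> \<inter> \<Omega>) \<psi>)"

definition contains_arbitrarily_large_balls :: "'a::metric_space set \<Rightarrow> bool" where
  "contains_arbitrarily_large_balls A \<longleftrightarrow> (\<forall>\<rho>>0. \<exists>x. ball x \<rho> \<subseteq> A)"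

end

theory Submission
  imports Defs
begin

text \<open>
  The set \<open>E\<close> is the union of a countable dense set (which removes isolated points) and of all
  \<open>\<psi>\<^sub>j(E\<^sub>i \<inter> \<Omega>\<^sub>j)\<close>, where the scales are distributed over infinitely many indices \<open>i\<close> and \<open>E\<^sub>i\<close>
  consists of the points that, at each scale \<open>n\<close> assigned to \<open>i\<close>, are \<open>e\<^sub>n\<^sub>+\<^sub>1\<close>-close to a locally finite
  \<open>e\<^sub>n/(2L)\<close>-net. Choosing \<open>e\<^sub>n\<^sub>+\<^sub>1\<close> tiny compared to the cardinality of the net makes \<open>E\<close> a null set.
  Given countably many \<open>f\<^sub>i\<close>, a common point is found in nested balls of radius \<open>e\<^sub>n\<close>: at a scale
  assigned to \<open>i\<close>, the ball contains the image of a net point under \<open>f\<^sub>i \<circ> \<psi>\<close>, which becomes the next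
  centre.
\<close>

section \<open>Null sets of the Hausdorff measure\<close>

lemma ennreal_eq_0I:
  fixes x :: ennreal
  assumes "\<And>\<epsilon>. 0 < \<epsilon> \<Longrightarrow> x \<le> ennreal \<epsilon>"
  shows "x = 0"
proof -
  have "x \<le> 0"
    by (rule ennreal_le_epsilon) (simp add: assms)
  then show ?thesis by simp
qed

text \<open>The premeasures grow as \<delta> shrinks, so their limit is a supremum and nullity can
  be tested at each fixed scale.\<close>

lemma hausdorff_measure_eq_0_iff:
  "hausdorff_measure h E = 0 \<longleftrightarrow> (\<forall>\<delta>>0. hausdorff_premeasure h \<delta> E = 0)"
proof -
  have "hausdorff_measure h E = (SUP \<delta>\<in>{0<..}. hausdorff_premeasure h \<delta> E)"
    using hausdorff_measure_tendsto hausdorff_premeasure_tendsto_SUP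
    by (rule tendsto_unique[OF trivial_limit_at_right_real])
  then show ?thesis
    by (auto simp: SUP_eq_iff simp flip: bot_ennreal)
qed

text \<open>The finite cover is enumerated and padded with empty sets, which have diameter 0 and
  cost \<open>h 0 = 0\<close>.\<close>

lemma hausdorff_premeasure_le_finite_cover:
  assumes "h 0 = 0" "0 \<le> \<delta>" "finite I" "E \<subseteq> (\<Union>i\<in>I. U i)"
    and "\<And>i. i \<in> I \<Longrightarrow> bounded (U i) \<and> diameter (U i) \<le> \<delta>"
  shows "hausdorff_premeasure h \<delta> E \<le> (\<Sum>i\<in>I. h (diameter (U i)))"
proof -
  obtain b where b: "bij_betw b {0..<card I} I"
    using ex_bij_betw_nat_finite[OF \<open>finite I\<close>] by blast
  define V where "V k = (if k < card I then U (b k) else {})" for k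
  have bI: "b k \<in> I" if "k < card I" for k
    using b that by (auto simp: bij_betw_def)
  have "(\<Union>i\<in>I. U i) \<subseteq> (\<Union>k. V k)"
  proof
    fix x assume "x \<in> (\<Union>i\<in>I. U i)"
    then obtain i where i: "i \<in> I" "x \<in> U i" by blast
    then obtain k where "k < card I" "b k = i"
      using b by (force simp: bij_betw_def)
    then show "x \<in> (\<Union>k. V k)"
      using i by (auto simp: V_def intro!: exI[of _ k])
  qed
  then have "delta_covering \<delta> V E"
    using assms bI by (auto simp: delta_covering_def V_def)
  then have "hausdorff_premeasure h \<delta> E \<le> (\<Sum>k. h (diameter (V k)))"
    unfolding hausdorff_premeasure_def by (intro INF_lower) simp
  also have "\<dots> = (\<Sum>k\<in>{0..<card I}. h (diameter (V k)))"
    using \<open>h 0 = 0\<close> by (intro suminf_finite) (auto simp: V_def)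
  also have "\<dots> = (\<Sum>k\<in>{0..<card I}. h (diameter (U (b k))))"
    by (intro sum.cong) (auto simp: V_def)
  also have "\<dots> = (\<Sum>i\<in>I. h (diameter (U i)))"
    using b by (rule sum.reindex_bij_betw)
  finally show ?thesis .
qed

text \<open>Cover the \<open>k\<close>-th set at cost below \<epsilon>/2^(k+1) and flatten the
  double sequence of covering sets into one.\<close>

lemma hausdorff_premeasure_UN_eq_0:
  fixes E :: "nat \<Rightarrow> 'a::metric_space set"
  assumes "\<And>k. hausdorff_premeasure h \<delta> (E k) = 0"
  shows "hausdorff_premeasure h \<delta> (\<Union>k. E k) = 0"
proof -
  have "hausdorff_premeasure h \<delta> (\<Union>k. E k) \<le> ennreal \<epsilon>" if "0 < \<epsilon>" for \<epsilon>
  proof -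
    have "\<exists>U. delta_covering \<delta> U (E k) \<and> (\<Sum>i. h (diameter (U i))) < ennreal (\<epsilon> * (1/2) ^ Suc k)" for k
    proof -
      have "0 < ennreal (\<epsilon> * (1/2) ^ Suc k)"
        using that by simp
      then have "(INF U\<in>{U. delta_covering \<delta> U (E k)}. \<Sum>i. h (diameter (U i))) < ennreal (\<epsilon> * (1/2) ^ Suc k)"
        using assms[of k] unfolding hausdorff_premeasure_def by simp
      then show ?thesis by (auto simp: INF_less_iff)
    qed
    then obtain U where U: "\<And>k. delta_covering \<delta> (U k) (E k)"
      and le: "\<And>k. (\<Sum>i. h (diameter (U k i))) < ennreal (\<epsilon> * (1/2) ^ Suc k)"
      by metis
    define V where "V m = (case prod_decode m of (k, i) \<Rightarrow> U k i)" for m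
    have "(\<Union>k. E k) \<subseteq> (\<Union>m. V m)"
    proof
      fix x assume "x \<in> (\<Union>k. E k)"
      then obtain k i where "x \<in> U k i"
        using U by (fastforce simp: delta_covering_def)
      then have "x \<in> V (prod_encode (k, i))" by (simp add: V_def)
      then show "x \<in> (\<Union>m. V m)" by blast
    qed
    then have "delta_covering \<delta> V (\<Union>k. E k)"
      using U by (auto simp: delta_covering_def V_def split: prod.split)
    then have "hausdorff_premeasure h \<delta> (\<Union>k. E k) \<le> (\<Sum>m. h (diameter (V m)))"
      unfolding hausdorff_premeasure_def by (intro INF_lower) simp
    also have "\<dots> = (\<Sum>m. (\<lambda>(k, i). h (diameter (U k i))) (prod_decode m))"
      by (simp add: V_def split_beta)
    also have "\<dots> = (\<Sum>k. \<Sum>i. h (diameter (U k i)))"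
      by (rule suminf_ennreal_2dimen) simp
    also have "\<dots> \<le> (\<Sum>k. ennreal (\<epsilon> * (1/2) ^ Suc k))"
      using le by (intro suminf_le) (auto intro: less_imp_le)
    also have "\<dots> = ennreal \<epsilon>"
      using that sums_mult[OF power_half_series, of \<epsilon>] by (intro suminf_ennreal_eq) auto
    finally show ?thesis .
  qed
  then show ?thesis by (rule ennreal_eq_0I)
qed

lemma hausdorff_measure_countable_Union_eq_0:
  assumes "countable \<C>" "\<C> \<noteq> {}" "\<And>C. C \<in> \<C> \<Longrightarrow> hausdorff_measure h C = 0"
  shows "hausdorff_measure h (\<Union>\<C>) = 0"
proof -
  have "\<Union>\<C> = (\<Union>k. from_nat_into \<C> k)"
    using assms by (simp add: range_from_nat_into)
  then show ?thesis
    using assms(3) from_nat_into[OF assms(2)]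
    by (auto simp: hausdorff_measure_eq_0_iff intro!: hausdorff_premeasure_UN_eq_0)
qed

lemma hausdorff_measure_finite_eq_0:
  assumes "h 0 = 0" "finite F"
  shows "hausdorff_measure h F = 0"
  unfolding hausdorff_measure_eq_0_iff
proof (intro allI impI)
  fix \<delta> :: real assume "0 < \<delta>"
  have "hausdorff_premeasure h \<delta> F \<le> (\<Sum>x\<in>F. h (diameter {x}))"
    by (rule hausdorff_premeasure_le_finite_cover) (use assms \<open>0 < \<delta>\<close> in auto)
  then show "hausdorff_premeasure h \<delta> F = 0"
    using assms by simp
qed

text \<open>A ball of radius \<open>d\<close> meets \<open>K\<close> in a set whose image has
  diameter at most \<open>2 * c * d\<close>, so the cover costs at most
  \<open>card P * h (2 * c * d)\<close>. A single \<eta> bounds both scale and cost, so that it can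
  be taken as \<open>min \<delta> \<epsilon>\<close>.\<close>

lemma hausdorff_measure_lipschitz_image_eq_0:
  fixes \<psi> :: "'a::real_normed_vector \<Rightarrow> 'b::real_normed_vector"
  assumes h: "dimension_function h" and "0 < c"
    and lip: "\<And>x y. x \<in> K \<Longrightarrow> y \<in> K \<Longrightarrow> norm (\<psi> x - \<psi> y) \<le> c * norm (x - y)"
    and cover: "\<And>\<eta>. 0 < \<eta> \<Longrightarrow> \<exists>P d. finite P \<and> K \<subseteq> (\<Union>p\<in>P. cball p d) \<and> 0 \<le> d \<and>
                  2 * c * d \<le> \<eta> \<and> of_nat (card P) * h (2 * c * d) \<le> ennreal \<eta>"
  shows "hausdorff_measure h (\<psi> ` K) = 0"
proof -
  have "hausdorff_premeasure h \<delta> (\<psi> ` K) \<le> ennreal \<epsilon>" if "0 < \<delta>" "0 < \<epsilon>" for \<delta> \<epsilon>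
  proof -
    have "0 < min \<delta> \<epsilon>" using that by simp
    from cover[OF this] obtain P d where P: "finite P" "K \<subseteq> (\<Union>p\<in>P. cball p d)" "0 \<le> d" "2 * c * d \<le> min \<delta> \<epsilon>"
      "of_nat (card P) * h (2 * c * d) \<le> ennreal (min \<delta> \<epsilon>)"
      by blast
    define U where "U p = \<psi> ` (K \<inter> cball p d)" for p
    have nrm: "norm (u - v) \<le> 2 * c * d" if uv: "u \<in> U p" "v \<in> U p" for u v p
    proof -
      obtain x y where xy: "x \<in> K" "y \<in> K" "dist p x \<le> d" "dist p y \<le> d" "u = \<psi> x" "v = \<psi> y"
        using uv by (auto simp: U_def)
      have "norm (x - y) \<le> 2 * d"
        using dist_triangle3[of x y p] xy by (simp add: dist_norm)
      then have "c * norm (x - y) \<le> c * (2 * d)"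
        using \<open>0 < c\<close> by simp
      then show ?thesis using lip[OF xy(1,2)] xy by simp
    qed
    have diam: "diameter (U p) \<le> 2 * c * d" for p
      using nrm \<open>0 < c\<close> \<open>0 \<le> d\<close> by (intro diameter_le) auto
    have bdd: "bounded (U p)" for p
      using nrm by (auto simp: bounded_two_points dist_norm)
    have "hausdorff_premeasure h \<delta> (\<psi> ` K) \<le> (\<Sum>p\<in>P. h (diameter (U p)))"
    proof (rule hausdorff_premeasure_le_finite_cover)
      show "\<psi> ` K \<subseteq> (\<Union>p\<in>P. U p)"
        using P(2) unfolding U_def by blast
      show "bounded (U p) \<and> diameter (U p) \<le> \<delta>" for p
        using bdd[of p] diam[of p] P(4) by simp
    qed (use h P that in \<open>auto simp: dimension_function_def\<close>)
    also have "\<dots> \<le> (\<Sum>p\<in>P. h (2 * c * d))"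
      using h diam bdd \<open>0 < c\<close> \<open>0 \<le> d\<close>
      by (intro sum_mono) (auto simp: dimension_function_def intro!: mono_onD[of "{0..}" h] diameter_ge_0)
    also have "\<dots> \<le> ennreal (min \<delta> \<epsilon>)"
      using P(5) by simp
    also have "\<dots> \<le> ennreal \<epsilon>"
      by (intro ennreal_leI) simp
    finally show ?thesis .
  qed
  then show ?thesis
    unfolding hausdorff_measure_eq_0_iff by (blast intro: ennreal_eq_0I)
qed

section \<open>F-sigma sets and isolated points\<close>

lemma fsigma_countable_Union:
  assumes "countable \<C>" "\<C> \<noteq> {}" "\<And>C. C \<in> \<C> \<Longrightarrow> closed C"
  shows "fsigma (\<Union>\<C>)"
proof -
  have "fsigma (\<Union>k. from_nat_into \<C> k)"
    using assms(3) from_nat_into[OF assms(2)] by (intro fsigma.intros) auto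
  then show ?thesis
    using assms by (simp add: range_from_nat_into)
qed

text \<open>In a perfect space, an open set isolating \<open>x\<close> stays open and nonempty after
  removing \<open>x\<close>, so it contains a further point of \<open>D\<close>.\<close>

lemma dense_superset_no_isolated:
  fixes D :: "'a::{perfect_space, t1_space} set"
  assumes "\<And>X. open X \<Longrightarrow> X \<noteq> {} \<Longrightarrow> \<exists>d\<in>D. d \<in> X" "D \<subseteq> E"
  shows "\<not> x isolated_in E"
proof
  assume "x isolated_in E"
  then obtain T where T: "open T" "T \<inter> E = {x}"
    by (auto simp: isolated_in_def)
  have "T \<noteq> {x}"
    using T(1) not_open_singleton by metis
  then have "T - {x} \<noteq> {}" using T(2) by blast
  moreover have "open (T - {x})" using T(1) by (intro open_Diff) auto
  ultimately obtain d where "d \<in> D" "d \<in> T - {x}"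
    using assms(1) by meson
  then show False
    using assms(2) T(2) by blast
qed

section \<open>Locally finite nets and domains of bilipschitz maps\<close>

text \<open>Each compact shell between radii \<open>k\<close> and \<open>k + 1\<close> has a finite
  net chosen inside it. A ball around 0 of radius \<open>R\<close> meets only the shells with
  \<open>k\<close> at most \<open>R\<close>, hence finitely many of these nets.\<close>

lemma locally_finite_net_exists:
  fixes s :: real
  assumes "0 < s"
  shows "\<exists>P :: 'a::euclidean_space set. (\<forall>x. \<exists>p\<in>P. dist p x < s) \<and> (\<forall>R. finite (P \<inter> cball 0 R))"
proof -
  define S where "S k = cball (0::'a) (real (Suc k)) - ball 0 (real k)" for k
  have "\<exists>F. finite F \<and> F \<subseteq> S k \<and> S k \<subseteq> (\<Union>p\<in>F. ball p s)" for k
  proof -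
    have "compact (S k)"
      unfolding S_def by (simp add: compact_diff)
    then show ?thesis
      using assms seq_compact_imp_totally_bounded compact_eq_seq_compact_metric by blast
  qed
  then obtain F where F: "\<And>k. finite (F k)" "\<And>k. F k \<subseteq> S k" "\<And>k. S k \<subseteq> (\<Union>p\<in>F k. ball p s)"
    by metis
  have "\<exists>p\<in>\<Union>k. F k. dist p x < s" for x
  proof -
    have "x \<in> S (nat \<lfloor>norm x\<rfloor>)"
      by (simp add: S_def) linarith
    then show ?thesis using F(3) by fastforce
  qed
  moreover have "finite ((\<Union>k. F k) \<inter> cball 0 R)" for R
  proof (rule finite_subset)
    show "(\<Union>k. F k) \<inter> cball 0 R \<subseteq> (\<Union>k\<in>{..nat \<lceil>R\<rceil>}. F k)"
    proof
      fix p assume "p \<in> (\<Union>k. F k) \<inter> cball 0 R"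
      then obtain k where k: "p \<in> F k" "norm p \<le> R" by auto
      then have "real k \<le> norm p"
        using F(2)[of k] by (auto simp: S_def)
      then have "k \<le> nat \<lceil>R\<rceil>"
        using k(2) by linarith
      then show "p \<in> (\<Union>k\<in>{..nat \<lceil>R\<rceil>}. F k)"
        using k by blast
    qed
  qed (use F in auto)
  ultimately show ?thesis by blast
qed

text \<open>
  By invariance of domain, the (contracting) inverse of \<open>g\<close> maps the ball around \<open>g x\<close> onto an open
  set, whose frontier stays at distance \<open>\<rho> / L\<close> from \<open>x\<close> because \<open>g\<close> expands by at most \<open>L\<close>.
\<close>

lemma ball_subset_bilipschitz_domain:
  fixes g :: "'a::euclidean_space \<Rightarrow> 'a"
  assumes g: "bilipschitz_on 1 L W g" and x: "x \<in> W" and sub: "cball (g x) \<rho> \<subseteq> g ` W"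
  shows "ball x (\<rho> / L) \<subseteq> W"
proof (cases "0 < \<rho>")
  case True
  have L: "0 < L" and lo: "\<And>u v. u \<in> W \<Longrightarrow> v \<in> W \<Longrightarrow> dist u v \<le> dist (g u) (g v)"
    and up: "\<And>u v. u \<in> W \<Longrightarrow> v \<in> W \<Longrightarrow> dist (g u) (g v) \<le> L * dist u v"
    using g by (auto simp: bilipschitz_on_def dist_norm)
  define G where "G = inv_into W g"
  have GW: "G v \<in> W" and gG: "g (G v) = v" if "v \<in> cball (g x) \<rho>" for v
    using that sub by (auto simp: G_def inv_into_into f_inv_into_f)
  \<comment> \<open>The lower constant 1 makes \<open>G\<close> nonexpansive.\<close>
  have cont: "continuous_on (cball (g x) \<rho>) G"
    unfolding continuous_on_iff
    by (metis GW gG lo le_less_trans)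
  have inj: "inj_on G (cball (g x) \<rho>)"
    using gG by (metis inj_onI)
  define T where "T = G ` ball (g x) \<rho>"
  have "open T"
    unfolding T_def
    by (rule invariance_of_domain) (use cont inj in \<open>auto intro: continuous_on_subset inj_on_subset ball_subset_cball\<close>)
  have "closed (G ` cball (g x) \<rho>)"
    using cont by (intro compact_imp_closed compact_continuous_image) auto
  then have "closure T \<subseteq> G ` cball (g x) \<rho>"
    unfolding T_def by (intro closure_minimal image_mono ball_subset_cball) auto
  \<comment> \<open>As \<open>T\<close> is open, its frontier is the part of its closure outside
    \<open>T\<close>, so only images of sphere points remain.\<close>
  then have fr: "frontier T \<subseteq> G ` sphere (g x) \<rho>"
    using \<open>open T\<close> by (force simp: frontier_def interior_open T_def less_le)
  have Gx: "G (g x) = x"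
    using lo[OF GW x, of "g x"] gG[of "g x"] True by simp
  have "ball x (\<rho> / L) \<inter> frontier T = {}"
  proof -
    have "\<rho> / L \<le> dist x w" if w: "w \<in> frontier T" for w
    proof -
      obtain v where v: "v \<in> sphere (g x) \<rho>" "w = G v" using subsetD[OF fr w] by blast
      then have "\<rho> \<le> L * dist x w"
        using up[OF x GW, of v] gG[of v] by simp
      then show ?thesis using L by (simp add: field_simps)
    qed
    then show ?thesis by force
  qed
  moreover have "ball x (\<rho> / L) \<inter> T \<noteq> {}"
    using True L Gx by (force simp: T_def intro!: image_eqI[of x G "g x"])
  \<comment> \<open>A connected set that meets \<open>T\<close> and misses its frontier lies in
    \<open>T\<close>.\<close>
  ultimately have "ball x (\<rho> / L) \<subseteq> T"
    using connected_Int_frontier[of "ball x (\<rho> / L)" T] by auto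
  also have "T \<subseteq> W"
    using GW by (auto simp: T_def)
  finally show ?thesis .
next
  case False
  then have "\<rho> / L \<le> 0"
    using g by (simp add: bilipschitz_on_def divide_nonpos_pos)
  then show ?thesis by (simp add: ball_empty)
qed

section \<open>Choice of the scales and nets\<close>

lemma dimension_function_small_scale:
  assumes "dimension_function h" "0 < \<eta>"
  shows "\<exists>t>0. t \<le> \<eta> \<and> of_nat m * h t \<le> ennreal \<eta>"
proof -
  have "(h \<longlongrightarrow> h 0) (at_right 0)" "h 0 = 0"
    using assms by (auto simp: dimension_function_def continuous_within)
  \<comment> \<open>The denominator \<open>m + 1\<close> keeps the bound meaningful for
    \<open>m = 0\<close>.\<close>
  then have "\<forall>\<^sub>F t in at_right 0. h t < ennreal (\<eta> / (real m + 1))"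
    using assms(2) by (intro order_tendstoD(2)) (auto simp: add_nonneg_pos)
  moreover have "\<forall>\<^sub>F t in at_right 0. t < \<eta>"
    using assms(2) by (intro order_tendstoD(2)[OF tendsto_ident_at])
  moreover have "\<forall>\<^sub>F t in at_right (0::real). 0 < t"
    by (rule eventually_at_right_less)
  ultimately have "\<forall>\<^sub>F t in at_right 0. 0 < t \<and> t < \<eta> \<and> h t < ennreal (\<eta> / (real m + 1))"
    by eventually_elim auto
  then obtain t where t: "0 < t" "t < \<eta>" "h t < ennreal (\<eta> / (real m + 1))"
    using eventually_happens[of _ "at_right (0::real)"] by auto
  have "of_nat m * h t \<le> ennreal (real m) * ennreal (\<eta> / (real m + 1))"
    using t(3) by (auto simp: ennreal_of_nat_eq_real_of_nat intro!: mult_mono)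
  also have "\<dots> = ennreal (real m * (\<eta> / (real m + 1)))"
    using assms(2) by (intro ennreal_mult[symmetric]) auto
  also have "\<dots> \<le> ennreal \<eta>"
    using assms(2) by (intro ennreal_leI) (simp add: field_simps)
  finally show ?thesis using t by force
qed

text \<open>The value \<open>e n\<close> fixes the net \<open>P n\<close>, and only then is
  \<open>e (Suc n)\<close> chosen, small enough for \<open>h\<close> to outweigh the number of net
  points in the ball of radius \<open>Suc n\<close>. The argument
  \<open>4 * Suc n * e (Suc n)\<close> dominates \<open>2 * c * d\<close> for every Lipschitz
  constant \<open>c\<close> up to \<open>Suc n\<close> and covering radius
  \<open>d = 2 * e (Suc n)\<close>.\<close>

lemma scales_exist:
  assumes h: "dimension_function h" and L: "0 < (L::real)"
  shows "\<exists>e (P :: nat \<Rightarrow> 'a::euclidean_space set). e 0 = 1 \<and> (\<forall>n. 0 < e n \<and> e (Suc n) \<le> e n / 2 \<and>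
    (\<forall>x. \<exists>p\<in>P n. dist p x < e n / (2 * L)) \<and> (\<forall>R. finite (P n \<inter> cball 0 R)) \<and>
    4 * real (Suc n) * e (Suc n) \<le> 1 / Suc n \<and>
    of_nat (card (P n \<inter> cball 0 (Suc n))) * h (4 * real (Suc n) * e (Suc n)) \<le> ennreal (1 / Suc n))"
proof -
  obtain net :: "real \<Rightarrow> 'a set" where net: "\<And>s. 0 < s \<Longrightarrow> (\<forall>x. \<exists>p\<in>net s. dist p x < s)"
    "\<And>s R. 0 < s \<Longrightarrow> finite (net s \<inter> cball 0 R)"
    using locally_finite_net_exists by metis
  let ?step = "\<lambda>n a b. b \<le> a / 2 \<and> 4 * real (Suc n) * b \<le> 1 / Suc n \<and>
    of_nat (card (net (a / (2 * L)) \<inter> cball 0 (Suc n))) * h (4 * real (Suc n) * b) \<le> ennreal (1 / Suc n)"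
  \<comment> \<open>The initial value is made part of the invariant, since dependent choice only
    promises some starting point.\<close>
  have "\<exists>e. \<forall>n. (0 < e n \<and> (n = 0 \<longrightarrow> e n = 1)) \<and> ?step n (e n) (e (Suc n))"
  proof (rule dependent_nat_choice)
    show "\<exists>a::real. 0 < a \<and> (0 = (0::nat) \<longrightarrow> a = 1)" by (intro exI[of _ 1]) simp
    fix a :: real and n :: nat assume a: "0 < a \<and> (n = 0 \<longrightarrow> a = 1)"
    let ?m = "card (net (a / (2 * L)) \<inter> cball 0 (Suc n))"
    obtain t where t: "0 < t" "t \<le> 1 / Suc n" "of_nat ?m * h t \<le> ennreal (1 / Suc n)"
      using dimension_function_small_scale[OF h, of "1 / Suc n" ?m] by auto
    define b where "b = min (a / 2) (t / (4 * real (Suc n)))"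
    have b: "0 < b" using a t by (simp add: b_def)
    have b2: "b \<le> a / 2" unfolding b_def by (rule min.cobounded1)
    have "b \<le> t / (4 * real (Suc n))" unfolding b_def by (rule min.cobounded2)
    then have bt: "4 * real (Suc n) * b \<le> t"
      by (simp add: pos_le_divide_eq mult.commute)
    have "h (4 * real (Suc n) * b) \<le> h t"
      using h bt b t unfolding dimension_function_def by (auto intro!: mono_onD[of "{0..}" h])
    then have "of_nat ?m * h (4 * real (Suc n) * b) \<le> of_nat ?m * h t"
      by (intro mult_left_mono) auto
    then have "?step n a b"
      using b2 bt t(2,3) by (meson order_trans)
    then show "\<exists>b. (0 < b \<and> (Suc n = 0 \<longrightarrow> b = 1)) \<and> ?step n a b"
      using b by blast
  qed
  then obtain e where e: "\<And>n. 0 < e n" "e 0 = 1" "\<And>n. ?step n (e n) (e (Suc n))" by metis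
  have "0 < e n / (2 * L)" for n using e(1)[of n] L by simp
  then show ?thesis
    using e net by (intro exI[of _ e] exI[of _ "\<lambda>n. net (e n / (2 * L))"]) blast
qed

section \<open>Multiscale sets: common points and nullity\<close>

text \<open>Pair decoding assigns infinitely many scales \<open>n\<close> to each \<open>i\<close>.
  For nonempty \<open>P n\<close> the condition is a closed neighbourhood of the net;
  \<open>infdist\<close> makes closedness immediate.\<close>

definition multiscale_set ::
  "(nat \<Rightarrow> 'a::metric_space set) \<Rightarrow> (nat \<Rightarrow> real) \<Rightarrow> nat \<Rightarrow> 'a set" where
  "multiscale_set P e i = {x. \<forall>n. fst (prod_decode n) = i \<longrightarrow> infdist x (P n) \<le> e (Suc n)}"

lemma closed_multiscale_set: "closed (multiscale_set P e i)"
proof -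
  have "closed {x. infdist x (P n) \<le> e (Suc n)}" for n
    by (intro closed_Collect_le continuous_intros)
  moreover have "multiscale_set P e i =
      (\<Inter>n\<in>{n. fst (prod_decode n) = i}. {x. infdist x (P n) \<le> e (Suc n)})"
    by (auto simp: multiscale_set_def)
  ultimately show ?thesis by auto
qed

text \<open>The upper constant \<open>L\<close> keeps the balls around images of net points nested.
  The lower constant 1 carries closeness of their common point to these images back to the
  domain.\<close>

lemma multiscale_sets_meet:
  fixes g :: "nat \<Rightarrow> 'a::euclidean_space \<Rightarrow> 'a"
  assumes g: "\<And>i. bilipschitz_on 1 L (W i) (g i)" and "0 < L"
    and y0: "cball y0 (e 0) \<subseteq> (\<Inter>i. g i ` W i)"
    and e: "\<And>n. 0 < e n" "\<And>n. e (Suc n) \<le> e n / 2"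
    and P: "\<And>n x. \<exists>p\<in>P n. dist p x < e n / (2 * L)"
  shows "(\<Inter>i. g i ` (multiscale_set P e i \<inter> W i)) \<noteq> {}"
proof -
  define c where "c n = fst (prod_decode n)" for n
  let ?A = "\<Inter>i. g i ` W i"
  have "\<exists>y. \<forall>n. cball (y n) (e n) \<subseteq> ?A \<and>
      (cball (y (Suc n)) (e (Suc n)) \<subseteq> cball (y n) (e n) \<and> (\<exists>p\<in>P n \<inter> W (c n). y (Suc n) = g (c n) p))"
  proof (rule dependent_nat_choice)
    show "\<exists>y. cball y (e 0) \<subseteq> ?A" using y0 by blast
    fix y n assume y: "cball y (e n) \<subseteq> ?A"
    then have "y \<in> g (c n) ` W (c n)"
      using e(1)[of n] by (meson INT_E UNIV_I centre_in_cball less_imp_le subsetD)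
    then obtain x where x: "x \<in> W (c n)" "y = g (c n) x" by blast
    \<comment> \<open>This guarantees that a net point close to \<open>x\<close> lies in the domain,
      so that \<open>g (c n)\<close> may be applied to it.\<close>
    have "ball x (e n / L) \<subseteq> W (c n)"
      using ball_subset_bilipschitz_domain[OF g x(1), of "e n"] y x(2) by auto
    moreover obtain p where p: "p \<in> P n" "dist p x < e n / (2 * L)" using P by blast
    moreover have "e n / (2 * L) \<le> e n / L"
      using e(1)[of n] \<open>0 < L\<close> by (simp add: field_simps)
    ultimately have pW: "p \<in> W (c n)" by (auto simp: dist_commute)
    then have "dist (g (c n) p) y \<le> L * dist p x"
      using g x by (auto simp: bilipschitz_on_def dist_norm)
    also have "\<dots> \<le> e n / 2"
      using p \<open>0 < L\<close> by (simp add: field_simps)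
    \<comment> \<open>The centre moves by at most \<open>e n / 2\<close> and the new radius is at
      most \<open>e n / 2\<close>.\<close>
    finally have "cball (g (c n) p) (e (Suc n)) \<subseteq> cball y (e n)"
      using e(2)[of n] by (simp add: cball_subset_cball_iff)
    then show "\<exists>z. cball z (e (Suc n)) \<subseteq> ?A \<and>
        (cball z (e (Suc n)) \<subseteq> cball y (e n) \<and> (\<exists>p\<in>P n \<inter> W (c n). z = g (c n) p))"
      using y p pW by blast
  qed
  then obtain y where y: "\<And>n. cball (y n) (e n) \<subseteq> ?A"
      "\<And>n. cball (y (Suc n)) (e (Suc n)) \<subseteq> cball (y n) (e n)"
      "\<And>n. \<exists>p\<in>P n \<inter> W (c n). y (Suc n) = g (c n) p"
    by metis
  have "\<Inter>(range (\<lambda>n. cball (y n) (e n))) \<noteq> {}"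
  proof (rule compact_nest)
    show "cball (y n) (e n) \<subseteq> cball (y m) (e m)" if "m \<le> n" for m n
      using y(2) that by (rule lift_Suc_antimono_le)
  qed (auto simp: not_less less_imp_le[OF e(1)])
  then obtain z where z: "\<And>n. z \<in> cball (y n) (e n)" by blast
  have "z \<in> g i ` (multiscale_set P e i \<inter> W i)" for i
  proof -
    have "z \<in> g i ` W i"
      using subsetD[OF y(1) z[of 0]] by (rule INT_D) simp
    \<comment> \<open>One preimage, fixed before \<open>n\<close>, serves all scales assigned to
      \<open>i\<close>.\<close>
    then obtain x where x: "x \<in> W i" "g i x = z" by blast
    have "infdist x (P n) \<le> e (Suc n)" if n: "c n = i" for n
    proof -
      obtain p where p: "p \<in> P n" "p \<in> W i" "y (Suc n) = g i p"
        using y(3)[of n] unfolding n by blast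
      have "dist x p \<le> dist (g i x) (g i p)"
        using g[of i] x p by (auto simp: bilipschitz_on_def dist_norm)
      also have "\<dots> \<le> e (Suc n)"
        using z[of "Suc n"] x p by (simp add: dist_commute)
      finally show ?thesis using infdist_le2[OF p(1)] by blast
    qed
    then show ?thesis
      using x by (auto simp: multiscale_set_def c_def)
  qed
  then show ?thesis by blast
qed

text \<open>On a ball where \<psi> is Lipschitz, a late enough scale assigned to \<open>i\<close>
  gives a cheap finite cover. Countably many such balls cover \<open>W\<close> by the Lindelof
  property.\<close>

lemma hausdorff_measure_image_multiscale_set:
  fixes \<psi> :: "'a::euclidean_space \<Rightarrow> 'b::real_normed_vector"
  assumes h: "dimension_function h" and psi: "locally_bilipschitz_on W \<psi>"
    and e: "e 0 = 1" "\<And>n. 0 < e n" "\<And>n. e (Suc n) \<le> e n / 2"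
    and P: "\<And>n. P n \<noteq> {}" "\<And>n R. finite (P n \<inter> cball 0 R)"
    and small: "\<And>n. 4 * real (Suc n) * e (Suc n) \<le> 1 / Suc n"
      "\<And>n. of_nat (card (P n \<inter> cball 0 (Suc n))) * h (4 * real (Suc n) * e (Suc n)) \<le> ennreal (1 / Suc n)"
  shows "hausdorff_measure h (\<psi> ` (multiscale_set P e i \<inter> W)) = 0"
proof -
  have e1: "e n \<le> 1" for n
  proof (induction n)
    case (Suc n) then show ?case using e(3)[of n] by simp
  qed (simp add: e)
  have piece: "hausdorff_measure h (\<psi> ` (multiscale_set P e i \<inter> (ball x \<epsilon> \<inter> W))) = 0"
    if bil: "bilipschitz_on c1 c (ball x \<epsilon> \<inter> W) \<psi>" for x \<epsilon> c1 c
  proof (rule hausdorff_measure_lipschitz_image_eq_0[OF h, of c])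
    show "0 < c" using bil by (simp add: bilipschitz_on_def)
    show "norm (\<psi> u - \<psi> v) \<le> c * norm (u - v)"
      if "u \<in> multiscale_set P e i \<inter> (ball x \<epsilon> \<inter> W)" "v \<in> multiscale_set P e i \<inter> (ball x \<epsilon> \<inter> W)" for u v
      using bil that by (auto simp: bilipschitz_on_def)
    fix \<eta> :: real assume "0 < \<eta>"
    obtain m :: nat where m: "max (max c (1 / \<eta>)) (norm x + \<epsilon> + 1) \<le> real m"
      using real_arch_simple by blast
    \<comment> \<open>This scale is assigned to \<open>i\<close> and is at least \<open>m\<close>,
      so it exceeds the Lipschitz constant, 1/\<eta> and the extent of the ball.\<close>
    define n where "n = prod_encode (i, m)"
    have n: "fst (prod_decode n) = i" "m \<le> n"
      by (auto simp: n_def le_prod_encode_2)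
    \<comment> \<open>Doubling turns the bound on \<open>infdist\<close> into a strict one, which
      yields an actual net point within \<open>d\<close>.\<close>
    define d where "d = 2 * e (Suc n)"
    have d: "0 < d" "d \<le> 1"
      using e(2)[of "Suc n"] e(3)[of n] e1[of n] by (auto simp: d_def)
    have n': "c \<le> Suc n" "1 / \<eta> \<le> Suc n" "norm x + \<epsilon> + 1 \<le> Suc n" using m n(2) by auto
    have "1 / Suc n \<le> \<eta>"
      using n'(2) \<open>0 < \<eta>\<close> by (simp add: field_simps)
    have cd: "2 * c * d \<le> 4 * real (Suc n) * e (Suc n)"
      using n'(1) e(2)[of "Suc n"] by (simp add: d_def del: of_nat_Suc)
    let ?P = "P n \<inter> cball 0 (Suc n)"
    have "multiscale_set P e i \<inter> (ball x \<epsilon> \<inter> W) \<subseteq> (\<Union>p\<in>?P. cball p d)"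
    proof
      fix u assume u: "u \<in> multiscale_set P e i \<inter> (ball x \<epsilon> \<inter> W)"
      then have "infdist u (P n) < d"
        using n(1) e(2)[of "Suc n"] by (auto simp: multiscale_set_def d_def intro: le_less_trans)
      then obtain p where p: "p \<in> P n" "dist u p < d"
        using P(1)[of n] by (auto simp: infdist_notempty cINF_less_iff)
      \<comment> \<open>Because \<open>d\<close> is at most 1, the net point stays in the ball of
        radius \<open>Suc n\<close>, where the net points were counted.\<close>
      have "norm p \<le> norm x + dist x u + dist u p"
        by norm
      also have "\<dots> \<le> Suc n"
        using u p d n'(3) by auto
      finally show "u \<in> (\<Union>p\<in>?P. cball p d)"
        using p by (auto simp: dist_commute intro!: bexI[of _ p] less_imp_le)
    qed
    moreover have "of_nat (card ?P) * h (2 * c * d) \<le> ennreal \<eta>"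
    proof -
      have "h (2 * c * d) \<le> h (4 * real (Suc n) * e (Suc n))"
        using h cd \<open>0 < c\<close> d e(2)[of "Suc n"]
        by (auto simp: dimension_function_def intro!: mono_onD[of "{0..}" h])
      then have "of_nat (card ?P) * h (2 * c * d) \<le> ennreal (1 / Suc n)"
        using small(2)[of n] by (meson mult_left_mono order_trans zero_le)
      also have "\<dots> \<le> ennreal \<eta>"
        using \<open>1 / Suc n \<le> \<eta>\<close> by (rule ennreal_leI)
      finally show ?thesis .
    qed
    moreover have "2 * c * d \<le> \<eta>"
      using cd small(1)[of n] \<open>1 / Suc n \<le> \<eta>\<close> by linarith
    ultimately show "\<exists>Q d. finite Q \<and> multiscale_set P e i \<inter> (ball x \<epsilon> \<inter> W) \<subseteq> (\<Union>p\<in>Q. cball p d) \<and>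
        0 \<le> d \<and> 2 * c * d \<le> \<eta> \<and> of_nat (card Q) * h (2 * c * d) \<le> ennreal \<eta>"
      using P(2) d by (intro exI[of _ ?P] exI[of _ d]) auto
  qed
  show ?thesis
  proof (cases "W = {}")
    case True
    have "h 0 = 0" using h by (simp add: dimension_function_def)
    then show ?thesis using True by (simp add: hausdorff_measure_finite_eq_0)
  next
    case False
    obtain \<epsilon> where eps: "\<And>x. x \<in> W \<Longrightarrow> 0 < \<epsilon> x" "\<And>x. x \<in> W \<Longrightarrow> \<exists>c1 c2. bilipschitz_on c1 c2 (ball x (\<epsilon> x) \<inter> W) \<psi>"
      using psi unfolding locally_bilipschitz_on_def by metis
    obtain V where V: "V \<subseteq> (\<lambda>x. ball x (\<epsilon> x)) ` W" "countable V" "\<Union>V = (\<Union>x\<in>W. ball x (\<epsilon> x))"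
      using Lindelof[of "(\<lambda>x. ball x (\<epsilon> x)) ` W"] by auto
    have "W \<subseteq> \<Union>V"
      using V(3) eps(1) by force
    then have eq: "\<psi> ` (multiscale_set P e i \<inter> W) = \<Union>((\<lambda>B. \<psi> ` (multiscale_set P e i \<inter> (B \<inter> W))) ` V)"
      by blast
    show ?thesis
      unfolding eq
    proof (rule hausdorff_measure_countable_Union_eq_0)
      show "(\<lambda>B. \<psi> ` (multiscale_set P e i \<inter> (B \<inter> W))) ` V \<noteq> {}"
        using False \<open>W \<subseteq> \<Union>V\<close> by auto
    qed (use V eps(2) piece in \<open>force+\<close>)
  qed
qed

theorem theorem4p1:
  fixes h :: "real \<Rightarrow> ennreal"
    and \<F> :: "(real ^ 'n \<Rightarrow> real ^ 'n) set"
    and \<Omega> :: "nat \<Rightarrow> (real ^ 'n) set"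
    and \<psi> :: "nat \<Rightarrow> real ^ 'n \<Rightarrow> real ^ 'n"
    and L :: int
    and r :: "(real ^ 'n \<Rightarrow> real ^ 'n) \<Rightarrow> nat"
  assumes "dimension_function h"
    and "\<And>f. f \<in> \<F> \<Longrightarrow> continuous_on UNIV f"
    and "\<And>j. closed (\<Omega> j)"
    and "\<And>j. closed_map (top_of_set (\<Omega> j)) euclidean (\<psi> j)"
    and "\<And>j. locally_bilipschitz_on (\<Omega> j) (\<psi> j)"
    and "L \<ge> 2"
    and "\<And>f. f \<in> \<F> \<Longrightarrow> bilipschitz_on 1 (of_int L) (\<Omega> (r f)) (f \<circ> \<psi> (r f))"
    and "\<And>(\<Lambda> :: nat set) f. (\<forall>i\<in>\<Lambda>. f i \<in> \<F>) \<Longrightarrow>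
           contains_arbitrarily_large_balls (\<Inter>i\<in>\<Lambda>. (f i \<circ> \<psi> (r (f i))) ` \<Omega> (r (f i)))"
  shows "\<exists>E :: (real ^ 'n) set.
           fsigma E \<and> (\<nexists>x. x isolated_in E) \<and> hausdorff_measure h E = 0 \<and>
           (\<forall>(\<Lambda> :: nat set) f. (\<forall>i\<in>\<Lambda>. f i \<in> \<F>) \<longrightarrow> (\<Inter>i\<in>\<Lambda>. f i ` E) \<noteq> {})"
proof -
  have h0: "h 0 = 0" using assms(1) by (simp add: dimension_function_def)
  have L: "0 < real_of_int L" using assms(6) by simp
  obtain e :: "nat \<Rightarrow> real" and P :: "nat \<Rightarrow> (real ^ 'n) set"
    where e: "e 0 = 1" "\<And>n. 0 < e n" "\<And>n. e (Suc n) \<le> e n / 2"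
      and P: "\<And>n x. \<exists>p\<in>P n. dist p x < e n / (2 * of_int L)" "\<And>n R. finite (P n \<inter> cball 0 R)"
      and small: "\<And>n. 4 * real (Suc n) * e (Suc n) \<le> 1 / Suc n"
        "\<And>n. of_nat (card (P n \<inter> cball 0 (Suc n))) * h (4 * real (Suc n) * e (Suc n)) \<le> ennreal (1 / Suc n)"
    using scales_exist[OF assms(1) L] by metis
  have Pne: "P n \<noteq> {}" for n using P(1)[of n] by blast
  obtain D :: "(real ^ 'n) set" where D: "countable D" "\<And>X. open X \<Longrightarrow> X \<noteq> {} \<Longrightarrow> \<exists>d\<in>D. d \<in> X"
    using countable_dense_setE by blast
  \<comment> \<open>Two independent indices are needed: the \<open>i\<close>-th function of a
    countable family may use any \<psi>.\<close>
  define K where "K i j = \<psi> j ` (multiscale_set P e i \<inter> \<Omega> j)" for i j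
  define \<C> where "\<C> = (\<lambda>(i, j). K i j) ` UNIV \<union> (\<lambda>d. {d}) ` D"
  have C: "countable \<C>" "\<C> \<noteq> {}"
    using D(1) by (auto simp: \<C>_def)
  \<comment> \<open>The multiscale set cut down to the domain is closed in it, and
    \<open>\<psi> j\<close> is a closed map.\<close>
  have "closed (K i j)" for i j
    using assms(3,4) closed_multiscale_set
    unfolding K_def closed_map_def by (metis closed_Int closed_closedin closedin_closed_Int inf_commute)
  then have "fsigma (\<Union>\<C>)"
    by (intro fsigma_countable_Union C) (auto simp: \<C>_def)
  moreover have "hausdorff_measure h (K i j) = 0" for i j
    unfolding K_def
    by (rule hausdorff_measure_image_multiscale_set[OF assms(1,5) e Pne P(2) small])
  then have "hausdorff_measure h (\<Union>\<C>) = 0"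
    by (intro hausdorff_measure_countable_Union_eq_0 C)
       (auto simp: \<C>_def hausdorff_measure_finite_eq_0 h0)
  moreover have "\<nexists>x. x isolated_in \<Union>\<C>"
    using dense_superset_no_isolated[OF D(2), of "\<Union>\<C>"] by (auto simp: \<C>_def)
  moreover have "(\<Inter>i\<in>\<Lambda>. f i ` \<Union>\<C>) \<noteq> {}" if f: "\<forall>i\<in>\<Lambda>. f i \<in> \<F>" for \<Lambda> :: "nat set" and f
  proof (cases "\<Lambda> = {}")
    case False
    then obtain k where k: "k \<in> \<Lambda>" by blast
    \<comment> \<open>Repeating one member extends the family to all natural numbers; this does not
      affect the functions indexed by \<Lambda>.\<close>
    define f' where "f' i = (if i \<in> \<Lambda> then f i else f k)" for i
    have f': "f' i \<in> \<F>" for i using f k by (auto simp: f'_def)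
    let ?g = "\<lambda>i. f' i \<circ> \<psi> (r (f' i))"
    have "contains_arbitrarily_large_balls (\<Inter>i. ?g i ` \<Omega> (r (f' i)))"
      using assms(8)[of UNIV f'] f' by simp
    then obtain y where y: "ball y 2 \<subseteq> (\<Inter>i. ?g i ` \<Omega> (r (f' i)))"
      unfolding contains_arbitrarily_large_balls_def by (meson zero_less_numeral)
    \<comment> \<open>Since \<open>e 0 = 1\<close>, any radius above 1 would do for the initial
      ball.\<close>
    have "cball y (e 0) \<subseteq> ball y 2" using e(1) by auto
    then have "(\<Inter>i. ?g i ` (multiscale_set P e i \<inter> \<Omega> (r (f' i)))) \<noteq> {}"
      using y by (intro multiscale_sets_meet[where L = "of_int L"] assms(7) f' L e(2,3) P(1)) blast
    then obtain z where z: "\<And>i. z \<in> ?g i ` (multiscale_set P e i \<inter> \<Omega> (r (f' i)))"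
      by (auto simp only: ex_in_conv[symmetric] INT_iff)
    have "?g i ` (multiscale_set P e i \<inter> \<Omega> (r (f' i))) \<subseteq> f i ` \<Union>\<C>" if "i \<in> \<Lambda>" for i
      using that by (auto simp: f'_def \<C>_def K_def)
    then have "z \<in> (\<Inter>i\<in>\<Lambda>. f i ` \<Union>\<C>)"
      by (intro INT_I subsetD[OF _ z])
    then show ?thesis by (metis empty_iff)
  qed simp
  ultimately show ?thesis by (intro exI[of _ "\<Union>\<C>"]) simp
qed

end
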